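(* Let $N\ge 1$ be an integer, let $\langle\mu_\alpha\rangle$ be a net of unit Borel measures on $\mathbf{P}^N_K$, and let $\mu$ be another unit Borel measure on $\mathbf{P}^N_K$. Then $\mu_\alpha\to\mu$ weakly if and only if $\int\lambda_f\,d\mu_\alpha\to\int\lambda_f\,d\mu$ for all normalized homogeneous polynomials $f\in K[X]$.
   Context: $K$ is a field complete with respect to a nontrivial non-archimedean absolute value $|\cdot|$, and $K[X]=K[X_0,\dots,X_N]$. For $f\in K[X]$, $H(f)$ is the maximum absolute value of the coefficients of $f$; $f$ is normalized if $H(f)=1$. Berkovich affine space: $\mathbf{A}^{N+1}_K$ is the set of multiplicative seminorms on $K[X]$ extending $|\cdot|$, i.e. functions $[\cdot]:K[X]\to[0,\infty)$ with $[a]=|a|$ for $a\in K$, $[f+g]\le\max\{[f],[g]\}$ and $[fg]=[f][g]$. The seminorm corresponding to a point $\zeta$ is written $[\cdot]_\zeta$. The topology is the weakest one making $\zeta\mapsto[f]_\zeta$ continuous for every $f\in K[X]$. The point $0$ is the seminorm $f\mapsto|f(0)|$. Put $\|\zeta\|=\max\{[X_0]_\zeta,\dots,[X_N]_\zeta\}$; then $\|\zeta\|=0$ iff $\zeta=0$. Berkovich projective space: $\mathbf{P}^N_K$ is the quotient of $\mathbf{A}^{N+1}_K\setminus\{0\}$, with the quotient topology, by the equivalence relation: $\zeta\sim\xi$ iff there is a constant $\lambda>0$ with $[f]_\zeta=\lambda^{\deg f}[f]_\xi$ for all homogeneous $f\in K[X]$. Let $\pi$ be the quotient map. For homogeneous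 $f\in K[X]$, the function $\lambda_f:\mathbf{P}^N_K\to\mathbb{R}$ is defined by $\lambda_f(\pi(\zeta))=[f]_\zeta/\|\zeta\|^{\deg f}$ (this is well defined on equivalence classes). A Borel measure is a positive measure on the Borel $\sigma$-algebra of $\mathbf{P}^N_K$; it is a unit measure if its total mass is $1$. For a net of Borel measures, $\mu_\alpha\to\mu$ weakly means $\int\varphi\,d\mu_\alpha\to\int\varphi\,d\mu$ for every continuous $\varphi:\mathbf{P}^N_K\to\mathbb{R}$. *)

theory Defs
  imports "HOL-Probability.Probability_Measure" "HOL-Library.Poly_Mapping"
begin

locale nonarch_complete =
  fixes absv :: "'k::field \<Rightarrow> real"
  assumes absv_nonneg: "0 \<le> absv a"
    and absv_eq_0_iff: "absv a = 0 \<longleftrightarrow> a = 0"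
    and absv_mult: "absv (a * b) = absv a * absv b"
    and absv_add: "absv (a + b) \<le> max (absv a) (absv b)"
    and absv_nontrivial: "\<exists>a. a \<noteq> 0 \<and> absv a \<noteq> 1"
    and absv_complete:
      "(\<forall>e>0. \<exists>M. \<forall>m\<ge>M. \<forall>n\<ge>M. absv (s m - s n) < e) \<Longrightarrow>
         \<exists>l. (\<lambda>n. absv (s n - l)) \<longlonglongrightarrow> 0"

text \<open>
  Polynomials over \<open>'k\<close> in variables indexed by \<open>'v\<close>, as finitely supported functions on the
  exponent vectors with the convolution product. The index type \<open>'v\<close> has \<open>N + 1\<close> elements for
  \<open>K[X\<^sub>0, \<dots>, X\<^sub>N]\<close>.
\<close>

type_synonym ('v, 'k) mvpoly = "('v \<Rightarrow>\<^sub>0 nat) \<Rightarrow>\<^sub>0 'k"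

definition mvconst :: "'k \<Rightarrow> ('v, 'k::zero) mvpoly" where
  "mvconst a = Poly_Mapping.single 0 a"

definition mvvar :: "'v \<Rightarrow> ('v, 'k::zero_neq_one) mvpoly" where
  "mvvar i = Poly_Mapping.single (Poly_Mapping.single i 1) 1"

definition mveval :: "('v::finite, 'k::comm_ring_1) mvpoly \<Rightarrow> ('v \<Rightarrow> 'k) \<Rightarrow> 'k" where
  "mveval f x = (\<Sum>m\<in>Poly_Mapping.keys f.
     Poly_Mapping.lookup f m * (\<Prod>i\<in>UNIV. x i ^ Poly_Mapping.lookup m i))"

definition monom_degree :: "('v::finite \<Rightarrow>\<^sub>0 nat) \<Rightarrow> nat" where
  "monom_degree m = (\<Sum>i\<in>UNIV. Poly_Mapping.lookup m i)"

text \<open>The zero polynomial gets degree \<open>0\<close>, and counts as homogeneous.\<close>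

definition mvdegree :: "('v::finite, 'k::zero) mvpoly \<Rightarrow> nat" where
  "mvdegree f = Max (insert 0 (monom_degree ` Poly_Mapping.keys f))"

definition homogeneous :: "('v::finite, 'k::zero) mvpoly \<Rightarrow> bool" where
  "homogeneous f \<longleftrightarrow> (\<exists>d. \<forall>m\<in>Poly_Mapping.keys f. monom_degree m = d)"

definition height :: "('k \<Rightarrow> real) \<Rightarrow> ('v, 'k::zero) mvpoly \<Rightarrow> real" where
  "height absv f = Max (insert 0 ((\<lambda>m. absv (Poly_Mapping.lookup f m)) ` Poly_Mapping.keys f))"

definition normalized :: "('k \<Rightarrow> real) \<Rightarrow> ('v, 'k::zero) mvpoly \<Rightarrow> bool" where
  "normalized absv f \<longleftrightarrow> height absv f = 1"

definition berk_affine :: "('k::field \<Rightarrow> real) \<Rightarrow> (('v, 'k) mvpoly \<Rightarrow> real) set" where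
  "berk_affine absv = {\<zeta>.
     (\<forall>f. 0 \<le> \<zeta> f) \<and>
     (\<forall>a. \<zeta> (mvconst a) = absv a) \<and>
     (\<forall>f g. \<zeta> (f + g) \<le> max (\<zeta> f) (\<zeta> g)) \<and>
     (\<forall>f g. \<zeta> (f * g) = \<zeta> f * \<zeta> g)}"

definition berk_affine_top :: "('k::field \<Rightarrow> real) \<Rightarrow> (('v, 'k) mvpoly \<Rightarrow> real) topology" where
  "berk_affine_top absv =
     topology_generated_by {{\<zeta> \<in> berk_affine absv. \<zeta> f \<in> U} | f U. open U}"

lemma topspace_berk_affine_top [simp]: "topspace (berk_affine_top absv) = berk_affine absv"
  unfolding berk_affine_top_def topology_generated_by_topspace by blast

definition berk_zero :: "('k::field \<Rightarrow> real) \<Rightarrow> ('v::finite, 'k) mvpoly \<Rightarrow> real" where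
  "berk_zero absv f = absv (mveval f (\<lambda>_. 0))"

definition berk_norm :: "(('v::finite, 'k::field) mvpoly \<Rightarrow> real) \<Rightarrow> real" where
  "berk_norm \<zeta> = Max ((\<lambda>i. \<zeta> (mvvar i)) ` UNIV)"

definition berk_punctured :: "('k::field \<Rightarrow> real) \<Rightarrow> (('v::finite, 'k) mvpoly \<Rightarrow> real) set" where
  "berk_punctured absv = berk_affine absv - {berk_zero absv}"

definition berk_rel ::
  "('k::field \<Rightarrow> real) \<Rightarrow>
     ((('v::finite, 'k) mvpoly \<Rightarrow> real) \<times> (('v, 'k) mvpoly \<Rightarrow> real)) set" where
  "berk_rel absv = {(\<zeta>, \<xi>). \<zeta> \<in> berk_punctured absv \<and> \<xi> \<in> berk_punctured absv \<and>
     (\<exists>l>0. \<forall>f. homogeneous f \<longrightarrow> \<zeta> f = l ^ mvdegree f * \<xi> f)}"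

type_synonym ('v, 'k) proj_point = "(('v, 'k) mvpoly \<Rightarrow> real) set"

definition berk_pi ::
  "('k::field \<Rightarrow> real) \<Rightarrow> (('v::finite, 'k) mvpoly \<Rightarrow> real) \<Rightarrow> ('v, 'k) proj_point" where
  "berk_pi absv \<zeta> = berk_rel absv `` {\<zeta>}"

definition berk_proj :: "('k::field \<Rightarrow> real) \<Rightarrow> ('v::finite, 'k) proj_point set" where
  "berk_proj absv = berk_punctured absv // berk_rel absv"

definition berk_proj_top :: "('k::field \<Rightarrow> real) \<Rightarrow> ('v::finite, 'k) proj_point topology" where
  "berk_proj_top absv = topology (\<lambda>U. U \<subseteq> berk_proj absv \<and>
     openin (subtopology (berk_affine_top absv) (berk_punctured absv))
       {\<zeta> \<in> berk_punctured absv. berk_pi absv \<zeta> \<in> U})"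

text \<open>The choice of representative does not matter on homogeneous \<open>f\<close>, see
  \<open>lambda_fun_berk_pi\<close> below.\<close>

definition lambda_fun :: "('v::finite, 'k::field) mvpoly \<Rightarrow> ('v, 'k) proj_point \<Rightarrow> real" where
  "lambda_fun f p = (let \<zeta> = (SOME \<zeta>. \<zeta> \<in> p) in \<zeta> f / berk_norm \<zeta> ^ mvdegree f)"

lemma equiv_berk_rel: "equiv (berk_punctured absv) (berk_rel absv)"
proof (rule equivI)
  show "berk_rel absv \<subseteq> berk_punctured absv \<times> berk_punctured absv"
    by (auto simp: berk_rel_def)
  show "refl_on (berk_punctured absv) (berk_rel absv)"
    by (auto simp: refl_on_def berk_rel_def intro!: exI[of _ 1])
  show "sym (berk_rel absv)"
  proof (rule symI)
    fix \<zeta> \<xi> assume "(\<zeta>, \<xi>) \<in> berk_rel absv"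
    then obtain l where l: "\<zeta> \<in> berk_punctured absv" "\<xi> \<in> berk_punctured absv" "l > 0"
      "\<And>f. homogeneous f \<Longrightarrow> \<zeta> f = l ^ mvdegree f * \<xi> f"
      by (auto simp: berk_rel_def)
    then have "\<xi> f = inverse l ^ mvdegree f * \<zeta> f" if "homogeneous f" for f
      using that by (simp add: field_simps)
    moreover have "inverse l > 0" using l by simp
    ultimately show "(\<xi>, \<zeta>) \<in> berk_rel absv" using l unfolding berk_rel_def by blast
  qed
  show "trans (berk_rel absv)"
  proof (rule transI)
    fix \<zeta> \<xi> \<eta> assume "(\<zeta>, \<xi>) \<in> berk_rel absv" "(\<xi>, \<eta>) \<in> berk_rel absv"
    then obtain l k where l: "\<zeta> \<in> berk_punctured absv" "\<eta> \<in> berk_punctured absv" "l > 0" "k > 0"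
      "\<And>f. homogeneous f \<Longrightarrow> \<zeta> f = l ^ mvdegree f * \<xi> f"
      "\<And>f. homogeneous f \<Longrightarrow> \<xi> f = k ^ mvdegree f * \<eta> f"
      by (auto simp: berk_rel_def)
    then have "\<zeta> f = (l * k) ^ mvdegree f * \<eta> f" if "homogeneous f" for f
      using that by (simp add: power_mult_distrib)
    moreover have "l * k > 0" using l by simp
    ultimately show "(\<zeta>, \<eta>) \<in> berk_rel absv" using l unfolding berk_rel_def by blast
  qed
qed

lemma openin_berk_proj_top:
  fixes absv :: "'k::field \<Rightarrow> real" and U :: "('v::finite, 'k) proj_point set"
  shows "openin (berk_proj_top absv) U \<longleftrightarrow> U \<subseteq> berk_proj absv \<and>
     openin (subtopology (berk_affine_top absv) (berk_punctured absv))
       {\<zeta> \<in> berk_punctured absv. berk_pi absv \<zeta> \<in> U}"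
proof -
  let ?T = "subtopology (berk_affine_top absv)
    (berk_punctured absv :: (('v, 'k) mvpoly \<Rightarrow> real) set)"
  let ?P = "\<lambda>U :: ('v, 'k) proj_point set. {\<zeta> \<in> berk_punctured absv. berk_pi absv \<zeta> \<in> U}"
  have inter: "?P (S \<inter> T) = ?P S \<inter> ?P T" for S T by auto
  have union: "?P (\<Union>\<K>) = \<Union> (?P ` \<K>)" for \<K> by auto
  have "istopology (\<lambda>U :: ('v, 'k) proj_point set. U \<subseteq> berk_proj absv \<and> openin ?T (?P U))"
    unfolding istopology_def inter union by (auto intro!: openin_Int openin_Union)
  then show ?thesis
    unfolding berk_proj_top_def by (simp add: topology_inverse')
qed

lemma berk_pi_image: "berk_pi absv ` berk_punctured absv = berk_proj absv"
  by (auto simp: berk_pi_def berk_proj_def quotient_def)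

lemma topspace_subtopology_berk_punctured [simp]:
  "topspace (subtopology (berk_affine_top absv) (berk_punctured absv)) = berk_punctured absv"
  by (auto simp: berk_punctured_def)

lemma topspace_berk_proj_top [simp]:
  fixes absv :: "'k::field \<Rightarrow> real"
  shows "topspace (berk_proj_top absv) = (berk_proj absv :: ('v::finite, 'k) proj_point set)"
proof -
  let ?A = "berk_punctured absv :: (('v, 'k) mvpoly \<Rightarrow> real) set"
  let ?B = "berk_proj absv :: ('v, 'k) proj_point set"
  have *: "{\<zeta> \<in> ?A. berk_pi absv \<zeta> \<in> ?B} = ?A"
    using berk_pi_image by blast
  have "openin (subtopology (berk_affine_top absv) ?A) ?A"
    using openin_topspace topspace_subtopology_berk_punctured by metis
  then have "openin (berk_proj_top absv) ?B"
    unfolding openin_berk_proj_top * by simp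
  then show ?thesis
    by (metis openin_berk_proj_top openin_subset openin_topspace subset_antisym)
qed

lemma quotient_map_berk_pi:
  "quotient_map (subtopology (berk_affine_top absv) (berk_punctured absv))
     (berk_proj_top absv) (berk_pi absv)"
  unfolding quotient_map_def topspace_subtopology_berk_punctured topspace_berk_proj_top
  by (simp add: berk_pi_image openin_berk_proj_top)

lemma homogeneous_mvvar: "homogeneous (mvvar i :: ('v::finite, 'k::zero_neq_one) mvpoly)"
  by (auto simp: homogeneous_def mvvar_def)

lemma mvdegree_mvvar: "mvdegree (mvvar i :: ('v::finite, 'k::zero_neq_one) mvpoly) = 1"
  by (simp add: mvdegree_def mvvar_def monom_degree_def lookup_single when_def)

lemma lambda_fun_berk_pi:
  assumes "\<zeta> \<in> berk_punctured absv" "homogeneous f"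
  shows "lambda_fun f (berk_pi absv \<zeta>) = \<zeta> f / berk_norm \<zeta> ^ mvdegree f"
proof -
  define \<xi> where "\<xi> = (SOME \<xi>. \<xi> \<in> berk_pi absv \<zeta>)"
  have "\<zeta> \<in> berk_pi absv \<zeta>"
    using assms(1) equiv_class_self[OF equiv_berk_rel] by (auto simp: berk_pi_def)
  then have "\<xi> \<in> berk_pi absv \<zeta>" unfolding \<xi>_def by (rule someI[where P = "\<lambda>\<xi>. \<xi> \<in> berk_pi absv \<zeta>"])
  then obtain l where l: "l > 0" "\<And>f. homogeneous f \<Longrightarrow> \<zeta> f = l ^ mvdegree f * \<xi> f"
    by (auto simp: berk_pi_def berk_rel_def)
  have "berk_norm \<zeta> = Max ((*) l ` (\<lambda>i. \<xi> (mvvar i)) ` UNIV)"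
    by (simp add: berk_norm_def image_image l(2) homogeneous_mvvar mvdegree_mvvar)
  also have "\<dots> = l * berk_norm \<xi>"
    unfolding berk_norm_def
    using l(1) by (subst mono_Max_commute[where f = "(*) l"]) (auto simp: mono_def)
  finally have "berk_norm \<zeta> = l * berk_norm \<xi>" .
  with l assms(2) show ?thesis
    by (simp add: lambda_fun_def Let_def power_mult_distrib flip: \<xi>_def)
qed

definition borel_of_top :: "'a topology \<Rightarrow> 'a measure" where
  "borel_of_top T = sigma (topspace T) {U. openin T U}"

definition unit_borel_measure :: "'a topology \<Rightarrow> 'a measure \<Rightarrow> bool" where
  "unit_borel_measure T M \<longleftrightarrow> sets M = sets (borel_of_top T) \<and> prob_space M"

definition directed_set :: "'i set \<Rightarrow> ('i \<Rightarrow> 'i \<Rightarrow> bool) \<Rightarrow> bool" where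
  "directed_set I le \<longleftrightarrow> I \<noteq> {} \<and> reflp_on I le \<and> transp_on I le \<and>
     (\<forall>i\<in>I. \<forall>j\<in>I. \<exists>k\<in>I. le i k \<and> le j k)"

text \<open>Net convergence over the directed set \<open>(I, le)\<close> is convergence along its filter of tails.\<close>

definition net_filter :: "'i set \<Rightarrow> ('i \<Rightarrow> 'i \<Rightarrow> bool) \<Rightarrow> 'i filter" where
  "net_filter I le = (INF i\<in>I. principal {j \<in> I. le i j})"

lemma eventually_net_filter:
  assumes "directed_set I le"
  shows "eventually P (net_filter I le) \<longleftrightarrow> (\<exists>i\<in>I. \<forall>j\<in>I. le i j \<longrightarrow> P j)"
  unfolding net_filter_def
proof (subst eventually_INF_base)
  show "I \<noteq> {}" using assms by (simp add: directed_set_def)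
next
  fix a b assume ab: "a \<in> I" "b \<in> I"
  then obtain k where "k \<in> I" "le a k" "le b k"
    using assms unfolding directed_set_def by blast
  moreover have "transp_on I le" using assms by (simp add: directed_set_def)
  ultimately show "\<exists>x\<in>I. principal {j \<in> I. le x j} \<le>
      inf (principal {j \<in> I. le a j}) (principal {j \<in> I. le b j})"
    using ab by (auto intro!: bexI[of _ k] dest: transp_onD)
qed (auto simp: eventually_principal)

definition weak_conv_net ::
  "'a topology \<Rightarrow> 'i filter \<Rightarrow> ('i \<Rightarrow> 'a measure) \<Rightarrow> 'a measure \<Rightarrow> bool" where
  "weak_conv_net T F \<mu>s \<mu> \<longleftrightarrow> (\<forall>\<phi>. continuous_map T euclideanreal \<phi> \<longrightarrow>
     ((\<lambda>\<alpha>. \<integral>x. \<phi> x \<partial>\<mu>s \<alpha>) \<longlongrightarrow> (\<integral>x. \<phi> x \<partial>\<mu>)) F)"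

end

theory Submission
  imports Defs
begin

text \<open>
  The functions \<open>\<lambda>\<^sub>f\<close> are continuous on projective space (\<open>continuous_map_lambda_fun\<close>), so weak
  convergence implies convergence of their integrals. The converse is the Stone--Weierstrass theorem:
  projective space is compact (\<open>compact_space_berk_proj_top\<close>), and the linear span of the functions
  \<open>\<lambda>\<^sub>f\<close> is an algebra of continuous functions that contains the constants and separates points. It is
  therefore uniformly dense, and a uniform limit may be exchanged with the integral against
  probability measures (\<open>weak_conv_net_if_separating\<close>).

  The span is closed under products because the seminorms are multiplicative, so that
  \<open>\<lambda>\<^sub>f \<lambda>\<^sub>g = \<lambda>\<^bsub>fg\<^esub>\<close> (\<open>lambda_fun_mult\<close>), and \<open>\<lambda>\<^bsub>fg\<^esub>\<close> is a multiple of \<open>\<lambda>\<^sub>h\<close> for some normalized \<open>h\<close>: a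
  nonzero homogeneous polynomial becomes normalized after division by a coefficient of largest
  absolute value, which changes \<open>\<lambda>\<close> by a positive factor (\<open>lambda_fun_eq_scaled_normalized\<close>). Points are separated because
  the equivalence relation on the punctured affine space compares exactly the values on homogeneous
  polynomials (\<open>berk_proj_eqI\<close>).

  For compactness, fix \<open>c \<in> K\<close> with \<open>\<bar>c\<bar> > 1\<close>. The annulus \<open>1 \<le> \<parallel>\<zeta>\<parallel> \<le> \<bar>c\<bar>\<close> in affine space is compact by
  Tychonoff's theorem (\<open>compact_berk_annulus\<close>). It meets every equivalence class, since precomposing
  a seminorm with the substitution \<open>X \<mapsto> dX\<close> moves it inside its class and multiplies \<open>\<parallel>\<zeta>\<parallel>\<close> by
  \<open>\<bar>d\<bar>\<close>, and the powers of \<open>c\<close> provide scalars \<open>d\<close> that reach the annulus. The annulus is as wide as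
  \<open>\<bar>c\<bar>\<close> because \<open>\<parallel>\<zeta>\<parallel>\<close> may lie outside the value group of \<open>K\<close>, in which case no scalar makes it
  equal to \<open>1\<close>.
\<close>

section \<open>Separation in function spaces\<close>

lemma open_coordinate_preimage:
  fixes W :: "'b::topological_space set"
  shows "open W \<Longrightarrow> open {f :: 'a \<Rightarrow> 'b. f i \<in> W}"
  using open_vimage[OF _ continuous_on_product_coordinates[of i], of W] unfolding vimage_def .

text \<open>
  Spaces of functions into Hausdorff spaces are Hausdorff; this makes the compact subsets of
  \<open>I \<Rightarrow> \<real>\<close>, with the product topology, available for the Stone--Weierstrass theorem. The weaker
  separation axioms are instantiated first because \<open>t2_space\<close> is a subclass of both.
\<close>

instance "fun" :: (type, t0_space) t0_space
proof
  fix x y :: "'a \<Rightarrow> 'b" assume "x \<noteq> y"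
  then obtain i where i: "x i \<noteq> y i" by auto
  obtain U where U: "open U" "\<not>(x i \<in> U \<longleftrightarrow> y i \<in> U)" using t0_space_class.t0_space[OF i] by auto
  with open_coordinate_preimage[OF U(1), of i] show "\<exists>U. open U \<and> \<not>(x \<in> U \<longleftrightarrow> y \<in> U)"
    by (intro exI[of _ "{f. f i \<in> U}"]) simp
qed

instance "fun" :: (type, t1_space) t1_space
proof
  fix x y :: "'a \<Rightarrow> 'b" assume "x \<noteq> y"
  then obtain i where i: "x i \<noteq> y i" by auto
  obtain U where U: "open U" "x i \<in> U" "y i \<notin> U" using t1_space[OF i] by auto
  with open_coordinate_preimage[OF U(1), of i] show "\<exists>U. open U \<and> x \<in> U \<and> y \<notin> U"
    by (intro exI[of _ "{f. f i \<in> U}"]) simp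
qed

instance "fun" :: (type, t2_space) t2_space
proof
  fix x y :: "'a \<Rightarrow> 'b" assume "x \<noteq> y"
  then obtain i where i: "x i \<noteq> y i" by auto
  obtain U V where UV: "open U" "open V" "x i \<in> U" "y i \<in> V" "U \<inter> V = {}"
    using hausdorff[OF i] by auto
  then show "\<exists>U V. open U \<and> open V \<and> x \<in> U \<and> y \<in> V \<and> U \<inter> V = {}"
    using open_coordinate_preimage[OF UV(1), of i] open_coordinate_preimage[OF UV(2), of i]
    by (intro exI[of _ "{f. f i \<in> U}"] exI[of _ "{f. f i \<in> V}"]) auto
qed

lemma Hausdorff_space_fun_real: "Hausdorff_space (euclidean :: ('a \<Rightarrow> real) topology)"
  unfolding euclidean_product_topology[symmetric] Hausdorff_space_product_topology by simp

section \<open>The Stone--Weierstrass theorem on compact topological spaces\<close>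

text \<open>
  The evaluation map \<open>x \<mapsto> (r x)\<^sub>r\<close> embeds it into a product of real lines, as it is continuous, injective
  because \<open>R\<close> separates points, and closed because its domain is compact. On the image, the functions
  in \<open>R\<close> become coordinate functions, and the theorem for compact subsets of a Hausdorff type applies.
\<close>

theorem Stone_Weierstrass_compact_space:
  fixes X :: "'a topology" and R :: "('a \<Rightarrow> real) set"
  assumes X: "compact_space X"
    and cont: "\<And>f. f \<in> R \<Longrightarrow> continuous_map X euclideanreal f"
    and add: "\<And>f g. f \<in> R \<Longrightarrow> g \<in> R \<Longrightarrow> (\<lambda>x. f x + g x) \<in> R"
    and mult: "\<And>f g. f \<in> R \<Longrightarrow> g \<in> R \<Longrightarrow> (\<lambda>x. f x * g x) \<in> R"
    and const: "\<And>c. (\<lambda>_. c) \<in> R"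
    and sep: "\<And>x y. \<lbrakk>x \<in> topspace X; y \<in> topspace X; x \<noteq> y\<rbrakk> \<Longrightarrow> \<exists>f\<in>R. f x \<noteq> f y"
    and \<phi>: "continuous_map X euclideanreal \<phi>" and "0 < e"
  shows "\<exists>g\<in>R. \<forall>x\<in>topspace X. \<bar>\<phi> x - g x\<bar> < e"
proof -
  \<comment> \<open>Coordinates outside \<open>R\<close> are set to \<open>0\<close>, so that the target is a full function type.\<close>
  define E :: "'a \<Rightarrow> ('a \<Rightarrow> real) \<Rightarrow> real" where "E x r = (if r \<in> R then r x else 0)" for x r
  define S where "S = E ` topspace X"
  define \<psi> where "\<psi> = \<phi> \<circ> inv_into (topspace X) E"
  define Q where "Q = {h. continuous_on S h \<and> (\<exists>r\<in>R. \<forall>x\<in>topspace X. h (E x) = r x)}"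
  have "continuous_map X euclideanreal (\<lambda>x. E x r)" for r
    by (cases "r \<in> R") (simp_all add: E_def cont)
  then have E: "continuous_map X euclidean E"
    unfolding euclidean_product_topology[symmetric] continuous_map_componentwise_UNIV by simp
  have inj: "inj_on E (topspace X)"
  proof (rule inj_onI, rule ccontr)
    fix x y assume xy: "x \<in> topspace X" "y \<in> topspace X" "E x = E y" "x \<noteq> y"
    then obtain r where r: "r \<in> R" "r x \<noteq> r y" using sep by auto
    from fun_cong[OF xy(3), of r] r show False by (simp add: E_def)
  qed
  have "compactin euclidean (E ` topspace X)"
    using X E unfolding compact_space_def by (rule image_compactin)
  then have "compact S" by (simp add: S_def)
  have q: "quotient_map X (subtopology euclidean S) E"
  proof (rule continuous_imp_quotient_map)
    show "continuous_map X (subtopology euclidean S) E"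
      using E by (auto simp: continuous_map_in_subtopology S_def)
    show "Hausdorff_space (subtopology euclidean S)"
      by (rule Hausdorff_space_subtopology[OF Hausdorff_space_fun_real])
  qed (auto simp: X S_def)
  have \<psi>E: "\<psi> (E x) = \<phi> x" if "x \<in> topspace X" for x
    using that inj by (simp add: \<psi>_def)
  have "continuous_map X euclideanreal (\<psi> \<circ> E)"
    using \<psi>E by (intro continuous_map_eq[OF \<phi>]) simp
  from continuous_compose_quotient_map[OF q this]
  have \<psi>: "continuous_on S \<psi>" by simp
  interpret function_ring_on Q S
  proof
    show "compact S" by fact
  next
    fix f assume "f \<in> Q" then show "continuous_on S f" by (simp add: Q_def)
  next
    fix f g assume "f \<in> Q" "g \<in> Q"
    then obtain r s where rs: "r \<in> R" "s \<in> R" "continuous_on S f" "continuous_on S g"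
      "\<forall>x\<in>topspace X. f (E x) = r x" "\<forall>x\<in>topspace X. g (E x) = s x" by (auto simp: Q_def)
    have "continuous_on S (\<lambda>x. f x + g x)" "continuous_on S (\<lambda>x. f x * g x)"
      using rs(3,4) by (rule continuous_on_add, rule continuous_on_mult)
    with rs(5,6) show "(\<lambda>x. f x + g x) \<in> Q" "(\<lambda>x. f x * g x) \<in> Q"
      unfolding Q_def by (auto intro: bexI[OF _ add[OF rs(1,2)]] bexI[OF _ mult[OF rs(1,2)]])
  next
    fix c :: real show "(\<lambda>_. c) \<in> Q"
      unfolding Q_def by (auto intro!: bexI[OF _ const[of c]])
  next
    fix x y assume xy: "x \<in> S" "y \<in> S" "x \<noteq> y"
    then obtain r where r: "x r \<noteq> y r" by auto
    then have "r \<in> R" using xy by (auto simp: S_def E_def split: if_splits)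
    have "continuous_on S (\<lambda>u. u r)"
      using continuous_on_product_coordinates by (rule continuous_on_subset) simp
    with \<open>r \<in> R\<close> have "(\<lambda>u. u r) \<in> Q"
      unfolding Q_def by (auto simp: E_def intro!: bexI[OF _ \<open>r \<in> R\<close>])
    with r show "\<exists>f\<in>Q. f x \<noteq> f y" by (intro bexI[of _ "\<lambda>u. u r"])
  qed
  from Stone_Weierstrass_basic[OF \<psi> \<open>0 < e\<close>]
  obtain h where h: "h \<in> Q" "\<forall>u\<in>S. \<bar>\<psi> u - h u\<bar> < e" by auto
  then obtain r where "r \<in> R" "\<forall>x\<in>topspace X. h (E x) = r x" by (auto simp: Q_def)
  with h(2) \<psi>E show ?thesis by (intro bexI[of _ r]) (auto simp: S_def)
qed

section \<open>A criterion for weak convergence\<close>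

inductive_set linear_combinations :: "('a \<Rightarrow> real) set \<Rightarrow> ('a \<Rightarrow> real) set"
  for L where
    base: "f \<in> L \<Longrightarrow> f \<in> linear_combinations L"
  | scale: "f \<in> linear_combinations L \<Longrightarrow> (\<lambda>x. c * f x) \<in> linear_combinations L"
  | add: "f \<in> linear_combinations L \<Longrightarrow> g \<in> linear_combinations L \<Longrightarrow>
      (\<lambda>x. f x + g x) \<in> linear_combinations L"

lemma continuous_map_linear_combinations:
  assumes "f \<in> linear_combinations L"
    and "\<And>f. f \<in> L \<Longrightarrow> continuous_map X euclideanreal f"
  shows "continuous_map X euclideanreal f"
  using assms by induction (auto intro!: continuous_intros)

text \<open>
  If a product of two generators is a multiple of a generator, then the span is an algebra. Products
  are compared on \<open>S\<close> only, since the functions of interest are meaningful only on the space.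
\<close>

lemma linear_combinations_mult:
  assumes L: "\<And>f g. f \<in> L \<Longrightarrow> g \<in> L \<Longrightarrow> \<exists>h\<in>L. \<exists>c. \<forall>x\<in>S. f x * g x = c * h x"
    and f: "f \<in> linear_combinations L" and g: "g \<in> linear_combinations L"
  shows "\<exists>h\<in>linear_combinations L. \<forall>x\<in>S. f x * g x = h x"
  using f
proof induction
  case (base f)
  from g show ?case
  proof induction
    case (base g)
    then obtain h c where "h \<in> L" "\<forall>x\<in>S. f x * g x = c * h x" using L[of f g] \<open>f \<in> L\<close> by auto
    then show ?case
      by (intro bexI[of _ "\<lambda>x. c * h x"]) (auto intro: linear_combinations.intros)
  next
    case (scale g c)
    then obtain h where "h \<in> linear_combinations L" "\<forall>x\<in>S. f x * g x = h x" by auto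
    then show ?case
      by (intro bexI[of _ "\<lambda>x. c * h x"]) (auto intro: linear_combinations.intros)
  next
    case (add g g')
    then obtain h h' where "h \<in> linear_combinations L" "\<forall>x\<in>S. f x * g x = h x"
      "h' \<in> linear_combinations L" "\<forall>x\<in>S. f x * g' x = h' x" by auto
    then show ?case
      by (intro bexI[of _ "\<lambda>x. h x + h' x"])
        (auto intro: linear_combinations.intros simp: distrib_left)
  qed
next
  case (scale f c)
  then obtain h where "h \<in> linear_combinations L" "\<forall>x\<in>S. f x * g x = h x" by auto
  then show ?case
    by (intro bexI[of _ "\<lambda>x. c * h x"]) (auto intro: linear_combinations.intros)
next
  case (add f f')
  then obtain h h' where "h \<in> linear_combinations L" "\<forall>x\<in>S. f x * g x = h x"
    "h' \<in> linear_combinations L" "\<forall>x\<in>S. f' x * g x = h' x" by auto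
  then show ?case
    by (intro bexI[of _ "\<lambda>x. h x + h' x"])
      (auto intro: linear_combinations.intros simp: distrib_right)
qed

lemma space_unit_borel_measure:
  assumes "unit_borel_measure T M"
  shows "space M = topspace T"
proof -
  have "sets M = sets (borel_of_top T)" using assms by (simp add: unit_borel_measure_def)
  then have "space M = space (borel_of_top T)" by (rule sets_eq_imp_space_eq)
  then show ?thesis
    by (auto simp: borel_of_top_def space_measure_of_conv)
qed

lemma integrable_continuous_map:
  fixes \<phi> :: "'a \<Rightarrow> real"
  assumes T: "compact_space T" and M: "unit_borel_measure T M"
    and \<phi>: "continuous_map T euclideanreal \<phi>"
  shows "integrable M \<phi>"
proof -
  interpret prob_space M using M by (simp add: unit_borel_measure_def)
  have sets: "sets M = sigma_sets (topspace T) {U. openin T U}"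
    using M openin_subset by (auto simp: unit_borel_measure_def borel_of_top_def sets_measure_of_conv)
  have "compact (\<phi> ` topspace T)"
    using image_compactin[OF _ \<phi>] T by (simp add: compact_space_def)
  then obtain B where "\<forall>y\<in>\<phi> ` topspace T. norm y \<le> B"
    using compact_imp_bounded bounded_iff by blast
  then have "AE x in M. norm (\<phi> x) \<le> B"
    using space_unit_borel_measure[OF M] by (intro AE_I2) simp
  moreover have "\<phi> \<in> borel_measurable M"
  proof (rule borel_measurableI)
    fix U :: "real set" assume "open U"
    then have "openin T {x \<in> topspace T. \<phi> x \<in> U}"
      using openin_continuous_map_preimage[OF \<phi>] by simp
    moreover have "{x \<in> topspace T. \<phi> x \<in> U} = \<phi> -` U \<inter> space M"
      using space_unit_borel_measure[OF M] by auto
    ultimately show "\<phi> -` U \<inter> space M \<in> sets M"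
      unfolding sets by (auto intro: sigma_sets.Basic)
  qed
  ultimately show ?thesis by (rule integrable_const_bound)
qed

lemma integral_uniformly_close:
  fixes \<phi> g :: "'a \<Rightarrow> real"
  assumes T: "compact_space T" and M: "unit_borel_measure T M"
    and \<phi>: "continuous_map T euclideanreal \<phi>" and g: "continuous_map T euclideanreal g"
    and close: "\<And>x. x \<in> topspace T \<Longrightarrow> \<bar>\<phi> x - g x\<bar> \<le> e"
  shows "\<bar>(\<integral>x. \<phi> x \<partial>M) - (\<integral>x. g x \<partial>M)\<bar> \<le> e"
proof -
  interpret prob_space M using M by (simp add: unit_borel_measure_def)
  note int = integrable_continuous_map[OF T M \<phi>] integrable_continuous_map[OF T M g]
  have "\<bar>(\<integral>x. \<phi> x \<partial>M) - (\<integral>x. g x \<partial>M)\<bar> = \<bar>\<integral>x. \<phi> x - g x \<partial>M\<bar>" using int by simp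
  also have "\<dots> \<le> (\<integral>x. \<bar>\<phi> x - g x\<bar> \<partial>M)" by (rule integral_abs_bound)
  also have "\<dots> \<le> (\<integral>x. e \<partial>M)"
    using int close space_unit_borel_measure[OF M] by (intro integral_mono) auto
  also have "\<dots> = e" by (simp add: prob_space)
  finally show ?thesis .
qed

text \<open>
  The span of \<open>L\<close> is uniformly dense in the continuous functions by Stone--Weierstrass. Convergence of
  integrals passes from \<open>L\<close> to its span by linearity, and from the span to its uniform closure by an
  \<open>\<epsilon>/3\<close> argument, since all measures involved have total mass \<open>1\<close>.
\<close>

theorem weak_conv_net_if_separating:
  fixes T :: "'a topology" and L :: "('a \<Rightarrow> real) set"
  assumes T: "compact_space T"
    and \<mu>s: "\<forall>\<^sub>F \<alpha> in F. unit_borel_measure T (\<mu>s \<alpha>)" and \<mu>: "unit_borel_measure T \<mu>"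
    and cont: "\<And>f. f \<in> L \<Longrightarrow> continuous_map T euclideanreal f"
    and one: "\<exists>h\<in>L. \<forall>x\<in>topspace T. h x = 1"
    and mult: "\<And>f g. f \<in> L \<Longrightarrow> g \<in> L \<Longrightarrow> \<exists>h\<in>L. \<exists>c. \<forall>x\<in>topspace T. f x * g x = c * h x"
    and sep: "\<And>x y. \<lbrakk>x \<in> topspace T; y \<in> topspace T; x \<noteq> y\<rbrakk> \<Longrightarrow> \<exists>f\<in>L. f x \<noteq> f y"
    and conv: "\<And>f. f \<in> L \<Longrightarrow> ((\<lambda>\<alpha>. \<integral>x. f x \<partial>\<mu>s \<alpha>) \<longlongrightarrow> (\<integral>x. f x \<partial>\<mu>)) F"
  shows "weak_conv_net T F \<mu>s \<mu>"
  unfolding weak_conv_net_def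
proof (intro allI impI)
  fix \<phi> assume \<phi>: "continuous_map T euclideanreal \<phi>"
  \<comment> \<open>The span is an algebra only up to equality on the space, hence this saturation of it.\<close>
  define R where "R = {f. \<exists>h\<in>linear_combinations L. \<forall>x\<in>topspace T. f x = h x}"
  have lc_cont: "continuous_map T euclideanreal h" if "h \<in> linear_combinations L" for h
    using that cont by (rule continuous_map_linear_combinations)
  have lc_conv: "((\<lambda>\<alpha>. \<integral>x. h x \<partial>\<mu>s \<alpha>) \<longlongrightarrow> (\<integral>x. h x \<partial>\<mu>)) F"
    if "h \<in> linear_combinations L" for h
    using that
  proof induction
    case (base f)
    then show ?case by (rule conv)
  next
    case (scale f c)
    then show ?case by (simp add: tendsto_mult_left)
  next
    case (add f g)
    note lim = tendsto_add[OF add.IH]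
    have int: "integrable M f" "integrable M g" if "unit_borel_measure T M" for M
      using integrable_continuous_map[OF T that] lc_cont add.hyps by auto
    have "\<forall>\<^sub>F \<alpha> in F. (\<integral>x. f x \<partial>\<mu>s \<alpha>) + (\<integral>x. g x \<partial>\<mu>s \<alpha>) = (\<integral>x. f x + g x \<partial>\<mu>s \<alpha>)"
      using \<mu>s by eventually_elim (simp add: int)
    from Lim_transform_eventually[OF lim this] show ?case by (simp add: int[OF \<mu>])
  qed
  have approx: "\<exists>h\<in>linear_combinations L. \<forall>x\<in>topspace T. \<bar>\<phi> x - h x\<bar> \<le> e" if "e > 0" for e
  proof -
    have "\<exists>g\<in>R. \<forall>x\<in>topspace T. \<bar>\<phi> x - g x\<bar> < e"
    proof (rule Stone_Weierstrass_compact_space[OF T _ _ _ _ _ \<phi> that])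
      fix f assume "f \<in> R"
      then obtain h where "h \<in> linear_combinations L" "\<forall>x\<in>topspace T. f x = h x"
        by (auto simp: R_def)
      then show "continuous_map T euclideanreal f"
        by (intro continuous_map_eq[OF lc_cont]) auto
    next
      fix f g assume "f \<in> R" "g \<in> R"
      then obtain h k where hk: "h \<in> linear_combinations L" "k \<in> linear_combinations L"
        "\<forall>x\<in>topspace T. f x = h x" "\<forall>x\<in>topspace T. g x = k x" by (auto simp: R_def)
      then have "\<forall>x\<in>topspace T. f x + g x = h x + k x" by simp
      with linear_combinations.add[OF hk(1,2)] show "(\<lambda>x. f x + g x) \<in> R"
        unfolding R_def mem_Collect_eq by (intro bexI[of _ "\<lambda>x. h x + k x"])
      have "\<exists>l\<in>linear_combinations L. \<forall>x\<in>topspace T. h x * k x = l x"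
        using mult hk(1,2) by (rule linear_combinations_mult)
      then obtain l where "l \<in> linear_combinations L" "\<forall>x\<in>topspace T. h x * k x = l x" ..
      then show "(\<lambda>x. f x * g x) \<in> R"
        using hk(3,4) unfolding R_def mem_Collect_eq by (intro rev_bexI[of l]) simp_all
    next
      fix c :: real
      from one obtain h where h: "h \<in> L" "\<forall>x\<in>topspace T. h x = 1" by auto
      from h(2) have "\<forall>x\<in>topspace T. c = c * h x" by simp
      with linear_combinations.scale[OF linear_combinations.base[OF h(1)]] show "(\<lambda>_. c) \<in> R"
        unfolding R_def mem_Collect_eq by (intro bexI[of _ "\<lambda>x. c * h x"])
    next
      fix x y assume "x \<in> topspace T" "y \<in> topspace T" "x \<noteq> y"
      then obtain f where "f \<in> L" "f x \<noteq> f y" using sep by auto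
      moreover from \<open>f \<in> L\<close> have "f \<in> R"
        unfolding R_def mem_Collect_eq by (intro rev_bexI[of f] linear_combinations.base) simp_all
      ultimately show "\<exists>f\<in>R. f x \<noteq> f y" by (intro rev_bexI[of f])
    qed
    then obtain g where g: "g \<in> R" "\<forall>x\<in>topspace T. \<bar>\<phi> x - g x\<bar> < e" by auto
    then obtain h where "h \<in> linear_combinations L" "\<forall>x\<in>topspace T. g x = h x"
      by (auto simp: R_def)
    with g(2) show ?thesis by (intro bexI[of _ h]) (auto intro: less_imp_le)
  qed
  show "((\<lambda>\<alpha>. \<integral>x. \<phi> x \<partial>\<mu>s \<alpha>) \<longlongrightarrow> (\<integral>x. \<phi> x \<partial>\<mu>)) F"
  proof (rule tendstoI)
    fix e :: real assume "e > 0"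
    then obtain h where h: "h \<in> linear_combinations L" "\<forall>x\<in>topspace T. \<bar>\<phi> x - h x\<bar> \<le> e / 3"
      using approx[of "e / 3"] by auto
    have close: "\<bar>(\<integral>x. \<phi> x \<partial>M) - (\<integral>x. h x \<partial>M)\<bar> \<le> e / 3" if "unit_borel_measure T M" for M
      using h(2) by (intro integral_uniformly_close[OF T that \<phi> lc_cont[OF h(1)]]) simp
    have "\<forall>\<^sub>F \<alpha> in F. dist (\<integral>x. h x \<partial>\<mu>s \<alpha>) (\<integral>x. h x \<partial>\<mu>) < e / 3"
      using tendstoD[OF lc_conv[OF h(1)], of "e / 3"] \<open>e > 0\<close> by simp
    with \<mu>s show "\<forall>\<^sub>F \<alpha> in F. dist (\<integral>x. \<phi> x \<partial>\<mu>s \<alpha>) (\<integral>x. \<phi> x \<partial>\<mu>) < e"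
    proof eventually_elim
      case (elim \<alpha>)
      with close[OF elim(1)] close[OF \<mu>] show ?case unfolding dist_real_def by linarith
    qed
  qed
qed

section \<open>Polynomials and rescaling of the variables\<close>

lemma poly_mapping_single_add_induct [case_names zero single add]:
  assumes "P 0" and "\<And>m a. P (Poly_Mapping.single m a)" and "\<And>f g. P f \<Longrightarrow> P g \<Longrightarrow> P (f + g)"
  shows "P (f :: 'a \<Rightarrow>\<^sub>0 'b::monoid_add)"
proof (induction f rule: update_induct)
  case const
  show ?case by (rule assms(1))
next
  case (update f a b)
  then have "Poly_Mapping.update a b f = Poly_Mapping.single a b + f"
    by (intro poly_mapping_eqI)
      (auto simp: lookup_update lookup_add lookup_single when_def in_keys_iff)
  with update show ?case using assms(2,3) by simp
qed

lemma lookup_mvconst_mult: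
  fixes f :: "('v, 'k::comm_ring_1) mvpoly"
  shows "Poly_Mapping.lookup (mvconst a * f) m = a * Poly_Mapping.lookup f m"
  by (induction f rule: poly_mapping_single_add_induct)
    (simp_all add: mvconst_def mult_single lookup_single when_def distrib_left lookup_add)

lemma mvconst_add: "mvconst (a + b) = (mvconst a + mvconst b :: ('v, 'k::comm_ring_1) mvpoly)"
  by (simp add: mvconst_def single_add)

lemma mvconst_mult_single:
  "mvconst a * Poly_Mapping.single m b = Poly_Mapping.single m (a * b :: 'k::comm_ring_1)"
  by (simp add: mvconst_def mult_single)

lemma monom_degree_0 [simp]: "monom_degree 0 = 0"
  by (simp add: monom_degree_def)

lemma monom_degree_single [simp]: "monom_degree (Poly_Mapping.single i n) = n"
  by (simp add: monom_degree_def lookup_single when_def)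

lemma monom_degree_add [simp]: "monom_degree (m + n) = monom_degree m + monom_degree n"
  by (simp add: monom_degree_def lookup_add sum.distrib)

lemma monom_degree_eq_0_iff [simp]: "monom_degree m = 0 \<longleftrightarrow> m = 0"
  by (auto simp: monom_degree_def poly_mapping_eq_iff fun_eq_iff)

lemma mveval_zero:
  fixes f :: "('v::finite, 'k::comm_ring_1) mvpoly"
  shows "mveval f (\<lambda>_. 0) = Poly_Mapping.lookup f 0"
proof -
  have "Poly_Mapping.lookup f m * (\<Prod>i\<in>UNIV. 0 ^ Poly_Mapping.lookup m i) =
      (if m = 0 then Poly_Mapping.lookup f 0 else 0)" for m
  proof (cases "m = 0")
    case False
    then obtain i where "Poly_Mapping.lookup m i \<noteq> 0" by (auto simp: poly_mapping_eq_iff fun_eq_iff)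
    then have "(\<Prod>i\<in>UNIV. (0 :: 'k) ^ Poly_Mapping.lookup m i) = 0"
      by (intro prod_zero bexI[of _ i]) (simp_all add: power_0_left)
    with False show ?thesis by simp
  qed simp
  then show ?thesis
    by (auto simp: mveval_def in_keys_iff)
qed

lemma mvdegree_eqI:
  assumes "f \<noteq> 0" "\<And>m. m \<in> Poly_Mapping.keys f \<Longrightarrow> monom_degree m = d"
  shows "mvdegree f = d"
proof -
  obtain m where "m \<in> Poly_Mapping.keys f" using assms(1) by fastforce
  with assms(2) have "monom_degree ` Poly_Mapping.keys f = {d}" by force
  then show ?thesis by (simp add: mvdegree_def)
qed

lemma homogeneous_monom_degree:
  assumes "homogeneous f" "m \<in> Poly_Mapping.keys f"
  shows "monom_degree m = mvdegree f"
proof -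
  obtain d where d: "\<And>m. m \<in> Poly_Mapping.keys f \<Longrightarrow> monom_degree m = d"
    using assms(1) by (auto simp: homogeneous_def)
  moreover have "f \<noteq> 0" using assms(2) by auto
  ultimately show ?thesis using mvdegree_eqI[of f d] assms(2) by simp
qed

lemma monom_degree_keys_mult:
  assumes "homogeneous f" "homogeneous g" "m \<in> Poly_Mapping.keys (f * g)"
  shows "monom_degree m = mvdegree f + mvdegree g"
proof -
  obtain a b where "m = a + b" "a \<in> Poly_Mapping.keys f" "b \<in> Poly_Mapping.keys g"
    using assms(3) keys_mult by blast
  then show ?thesis
    using homogeneous_monom_degree[OF assms(1)] homogeneous_monom_degree[OF assms(2)] by simp
qed

lemma homogeneous_mult:
  assumes "homogeneous f" "homogeneous g"
  shows "homogeneous (f * g)"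
  using monom_degree_keys_mult[OF assms] by (auto simp: homogeneous_def)

lemma mvdegree_mult:
  assumes "homogeneous f" "homogeneous g" "f * g \<noteq> 0"
  shows "mvdegree (f * g) = mvdegree f + mvdegree g"
  using assms monom_degree_keys_mult by (intro mvdegree_eqI)

lemma homogeneous_mvconst: "homogeneous (mvconst a)"
  by (auto simp: homogeneous_def mvconst_def)

lemma mvdegree_mvconst: "mvdegree (mvconst a) = 0"
  by (simp add: mvdegree_def mvconst_def)

text \<open>
  The substitution \<open>f(X) \<mapsto> f(cX)\<close>, in terms of coefficients.
\<close>

definition scale_vars :: "'k \<Rightarrow> ('v::finite, 'k::comm_ring_1) mvpoly \<Rightarrow> ('v, 'k) mvpoly" where
  "scale_vars c f = Poly_Mapping.mapp (\<lambda>m a. c ^ monom_degree m * a) f"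

lemma lookup_scale_vars:
  "Poly_Mapping.lookup (scale_vars c f) m = c ^ monom_degree m * Poly_Mapping.lookup f m"
  by (simp add: scale_vars_def lookup_mapp when_def in_keys_iff)

lemma scale_vars_single:
  "scale_vars c (Poly_Mapping.single m a) = Poly_Mapping.single m (c ^ monom_degree m * a)"
  by (rule poly_mapping_eqI) (simp add: lookup_scale_vars lookup_single when_def)

lemma scale_vars_add: "scale_vars c (f + g) = scale_vars c f + scale_vars c g"
  by (rule poly_mapping_eqI) (simp add: lookup_scale_vars lookup_add distrib_left)

lemma scale_vars_zero: "scale_vars c 0 = 0"
  by (rule poly_mapping_eqI) (simp add: lookup_scale_vars)

lemma scale_vars_mvconst: "scale_vars c (mvconst a) = mvconst a"
  by (simp add: mvconst_def scale_vars_single)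

lemma scale_vars_mult: "scale_vars c (f * g) = scale_vars c f * scale_vars c g"
proof (induction f rule: poly_mapping_single_add_induct)
  case (single m a)
  show ?case
  proof (induction g rule: poly_mapping_single_add_induct)
    case (single n b)
    then show ?case by (simp add: mult_single scale_vars_single power_add mult_ac)
  qed (simp_all add: scale_vars_add distrib_left scale_vars_zero)
qed (simp_all add: scale_vars_add distrib_right scale_vars_zero)

text \<open>
  On homogeneous polynomials the substitution is multiplication by a scalar, which is why a seminorm
  stays in its class when it is precomposed with it.
\<close>

lemma scale_vars_homogeneous:
  assumes "homogeneous f"
  shows "scale_vars c f = mvconst (c ^ mvdegree f) * f"
proof (rule poly_mapping_eqI)
  fix m
  show "Poly_Mapping.lookup (scale_vars c f) m = Poly_Mapping.lookup (mvconst (c ^ mvdegree f) * f) m"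
    using homogeneous_monom_degree[OF assms, of m]
    by (cases "m \<in> Poly_Mapping.keys f")
      (simp_all add: lookup_scale_vars lookup_mvconst_mult in_keys_iff)
qed

section \<open>Absolute values\<close>

lemma absv_one: "nonarch_complete absv \<Longrightarrow> absv 1 = 1"
  using nonarch_complete.absv_mult[of absv 1 1] nonarch_complete.absv_eq_0_iff[of absv 1] by simp

lemma absv_zero: "nonarch_complete absv \<Longrightarrow> absv 0 = 0"
  by (simp add: nonarch_complete.absv_eq_0_iff)

lemma absv_power: "nonarch_complete absv \<Longrightarrow> absv (a ^ n) = absv a ^ n"
  by (induction n) (simp_all add: absv_one nonarch_complete.absv_mult)

lemma absv_divide:
  assumes "nonarch_complete absv"
  shows "absv (a / b) = absv a / absv b"
proof (cases "b = 0")
  case False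
  then have "absv (a / b) * absv b = absv a"
    by (simp flip: nonarch_complete.absv_mult[OF assms])
  then show ?thesis using False nonarch_complete.absv_eq_0_iff[OF assms, of b] by (simp add: field_simps)
qed (simp add: absv_zero[OF assms])

lemma ex_absv_gt_1:
  assumes "nonarch_complete absv"
  shows "\<exists>c. 1 < absv c"
proof -
  obtain a where a: "a \<noteq> 0" "absv a \<noteq> 1"
    using nonarch_complete.absv_nontrivial[OF assms] by auto
  have "absv a > 0"
    using nonarch_complete.absv_nonneg[OF assms, of a] nonarch_complete.absv_eq_0_iff[OF assms, of a] a
    by auto
  show ?thesis
  proof (cases "absv a > 1")
    case False
    with a \<open>absv a > 0\<close> have "absv (1 / a) > 1"
      by (simp add: absv_divide[OF assms] absv_one[OF assms])
    then show ?thesis ..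
  qed auto
qed

text \<open>
  For \<open>d = c\<^sup>j\<close>, \<open>j \<in> \<int>\<close>, the values \<open>\<bar>d\<bar> r\<close> form a geometric progression of ratio \<open>\<bar>c\<bar>\<close>, and one of
  them falls between \<open>1\<close> and \<open>\<bar>c\<bar>\<close>. To avoid integer exponents, \<open>r\<close> is first multiplied up beyond
  \<open>1\<close> and then divided down as far as \<open>\<bar>c\<bar>\<close>.
\<close>

lemma ex_rescale_into_annulus:
  assumes absv: "nonarch_complete absv" and c: "1 < absv c" and "0 < r"
  shows "\<exists>d. 1 \<le> absv d * r \<and> absv d * r \<le> absv c"
proof -
  obtain m where m: "1 / r < absv c ^ m" using real_arch_pow[OF c] by auto
  define s where "s = absv c ^ m * r"
  have "1 \<le> s" using m \<open>0 < r\<close> by (simp add: s_def field_simps)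
  obtain k where k: "s < absv c ^ k" using real_arch_pow[OF c] by auto
  define n where "n = (LEAST n. s \<le> absv c ^ Suc n)"
  have "absv c ^ k \<le> absv c ^ Suc k" using c by (intro power_increasing) auto
  with k have "s \<le> absv c ^ Suc k" by linarith
  then have n: "s \<le> absv c ^ Suc n" unfolding n_def by (rule LeastI)
  have pos: "absv c ^ n > 0" using c by simp
  have "absv c ^ n \<le> s"
  proof (cases n)
    case 0
    then show ?thesis using \<open>1 \<le> s\<close> by simp
  next
    case (Suc j)
    then have "\<not> s \<le> absv c ^ Suc j" using not_less_Least[of j "\<lambda>n. s \<le> absv c ^ Suc n"] n_def by simp
    then show ?thesis using Suc by simp
  qed
  with n pos show ?thesis
    by (intro exI[of _ "c ^ m / c ^ n"])
      (simp add: absv_divide[OF absv] absv_power[OF absv] s_def field_simps)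
qed

section \<open>Berkovich affine space\<close>

lemma berk_affineD:
  assumes "\<zeta> \<in> berk_affine absv"
  shows "0 \<le> \<zeta> f" "\<zeta> (mvconst a) = absv a" "\<zeta> (f + g) \<le> max (\<zeta> f) (\<zeta> g)" "\<zeta> (f * g) = \<zeta> f * \<zeta> g"
  using assms by (simp_all add: berk_affine_def)

lemma berk_affine_zero:
  assumes "nonarch_complete absv" "\<zeta> \<in> berk_affine absv"
  shows "\<zeta> 0 = 0"
  using berk_affineD(2)[OF assms(2), of 0] absv_zero[OF assms(1)] by (simp add: mvconst_def)

lemma berk_norm_ge: "\<zeta> (mvvar i) \<le> berk_norm \<zeta>"
  by (simp add: berk_norm_def)

lemma berk_norm_nonneg:
  assumes "\<zeta> \<in> berk_affine absv"
  shows "0 \<le> berk_norm \<zeta>"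
  using berk_affineD(1)[OF assms] berk_norm_ge order_trans by blast

lemma berk_affine_monomial_le:
  assumes absv: "nonarch_complete absv" and \<zeta>: "\<zeta> \<in> berk_affine absv"
  shows "\<zeta> (Poly_Mapping.single m 1) \<le> berk_norm \<zeta> ^ monom_degree m"
proof (induction m rule: poly_mapping_single_add_induct)
  case zero
  show ?case using berk_affineD(2)[OF \<zeta>, of 1] absv_one[OF absv] by (simp add: mvconst_def)
next
  case (single i n)
  have "\<zeta> (Poly_Mapping.single (Poly_Mapping.single i n) 1) = \<zeta> (mvvar i) ^ n"
  proof (induction n)
    case 0
    show ?case using berk_affineD(2)[OF \<zeta>, of 1] absv_one[OF absv] by (simp add: mvconst_def)
  next
    case (Suc n)
    have "Poly_Mapping.single (Poly_Mapping.single i (Suc n)) 1 =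
        mvvar i * Poly_Mapping.single (Poly_Mapping.single i n) (1 :: 'a)"
      by (simp add: mvvar_def mult_single flip: single_add)
    then show ?case using Suc by (simp add: berk_affineD(4)[OF \<zeta>])
  qed
  then show ?case
    using berk_norm_ge[of \<zeta> i] berk_affineD(1)[OF \<zeta>] by (simp add: power_mono)
next
  case (add m n)
  have "Poly_Mapping.single (m + n) 1 =
      Poly_Mapping.single m 1 * Poly_Mapping.single n (1 :: 'a)"
    by (simp add: mult_single)
  then show ?case
    using add berk_affineD(1)[OF \<zeta>] berk_norm_nonneg[OF \<zeta>]
    by (simp add: berk_affineD(4)[OF \<zeta>] power_add mult_mono)
qed

lemma berk_affine_single_le:
  assumes absv: "nonarch_complete absv" and \<zeta>: "\<zeta> \<in> berk_affine absv"
  shows "\<zeta> (Poly_Mapping.single m a) \<le> absv a * berk_norm \<zeta> ^ monom_degree m"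
proof -
  have "\<zeta> (Poly_Mapping.single m a) = absv a * \<zeta> (Poly_Mapping.single m 1)"
    using berk_affineD(4)[OF \<zeta>, of "mvconst a" "Poly_Mapping.single m 1"]
    by (simp add: mvconst_mult_single berk_affineD(2)[OF \<zeta>])
  then show ?thesis
    using berk_affine_monomial_le[OF assms] nonarch_complete.absv_nonneg[OF absv]
    by (simp add: mult_left_mono)
qed

text \<open>
  A polynomial is bounded on each polydisc: monomials are bounded by powers of the radius, and the
  ultrametric inequality extends this to sums. These bounds provide the compact intervals in which
  Tychonoff's theorem confines the annulus.
\<close>

lemma berk_affine_bounded:
  fixes f :: "('v::finite, 'k::field) mvpoly"
  assumes absv: "nonarch_complete absv"
  shows "\<exists>B. \<forall>\<zeta>\<in>berk_affine absv. berk_norm \<zeta> \<le> r \<longrightarrow> \<zeta> f \<le> B"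
proof (induction f rule: poly_mapping_single_add_induct)
  case zero
  show ?case by (intro exI[of _ 0]) (simp add: berk_affine_zero[OF absv])
next
  case (single m a)
  have "\<zeta> (Poly_Mapping.single m a) \<le> absv a * r ^ monom_degree m"
    if "\<zeta> \<in> berk_affine absv" "berk_norm \<zeta> \<le> r" for \<zeta>
  proof -
    note berk_affine_single_le[OF absv that(1), of m a]
    also have "absv a * berk_norm \<zeta> ^ monom_degree m \<le> absv a * r ^ monom_degree m"
      using that berk_norm_nonneg nonarch_complete.absv_nonneg[OF absv]
      by (intro mult_left_mono power_mono) auto
    finally show ?thesis .
  qed
  then show ?case by auto
next
  case (add f g)
  then obtain A B where AB: "\<forall>\<zeta>\<in>berk_affine absv. berk_norm \<zeta> \<le> r \<longrightarrow> \<zeta> f \<le> A"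
    "\<forall>\<zeta>\<in>berk_affine absv. berk_norm \<zeta> \<le> r \<longrightarrow> \<zeta> g \<le> B" by auto
  have "\<zeta> (f + g) \<le> max A B" if "\<zeta> \<in> berk_affine absv" "berk_norm \<zeta> \<le> r" for \<zeta>
    using berk_affineD(3)[OF that(1), of f g] AB that by fastforce
  then show ?case by auto
qed

text \<open>
  If all variables have seminorm \<open>0\<close>, so has every polynomial without constant term. Hence \<open>f\<close> and
  its constant term differ by an element of seminorm \<open>0\<close>, and so have the same seminorm.
\<close>

lemma berk_norm_eq_0_imp:
  fixes \<zeta> :: "('v::finite, 'k::field) mvpoly \<Rightarrow> real"
  assumes absv: "nonarch_complete absv" and \<zeta>: "\<zeta> \<in> berk_affine absv" and norm: "berk_norm \<zeta> = 0"
  shows "\<zeta> = berk_zero absv"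
proof
  fix f :: "('v, 'k) mvpoly"
  define c :: "('v, 'k) mvpoly" where "c = mvconst (Poly_Mapping.lookup f 0)"
  have "\<zeta> (f - mvconst (Poly_Mapping.lookup f 0)) = 0"
  proof (induction f rule: poly_mapping_single_add_induct)
    case zero
    then show ?case using berk_affine_zero[OF absv \<zeta>] by (simp add: mvconst_def)
  next
    case (single m a)
    show ?case
    proof (cases "m = 0")
      case True
      then show ?thesis using berk_affine_zero[OF absv \<zeta>] by (simp add: mvconst_def)
    next
      case False
      then have "\<zeta> (Poly_Mapping.single m a) \<le> 0"
        using berk_affine_single_le[OF absv \<zeta>, of m a] norm by (simp add: power_0_left)
      with False show ?thesis
        using berk_affineD(1)[OF \<zeta>, of "Poly_Mapping.single m a"]
        by (simp add: mvconst_def lookup_single when_def)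
    qed
  next
    case (add f g)
    have "f + g - mvconst (Poly_Mapping.lookup (f + g) 0) =
        (f - mvconst (Poly_Mapping.lookup f 0)) + (g - mvconst (Poly_Mapping.lookup g 0))"
      by (simp add: lookup_add mvconst_add)
    then have "\<zeta> (f + g - mvconst (Poly_Mapping.lookup (f + g) 0)) \<le> 0"
      using berk_affineD(3)[OF \<zeta>, of "f - mvconst (Poly_Mapping.lookup f 0)"
          "g - mvconst (Poly_Mapping.lookup g 0)"] add by (simp only: max.idem)
    then show ?case
      using berk_affineD(1)[OF \<zeta>, of "f + g - mvconst (Poly_Mapping.lookup (f + g) 0)"]
      by linarith
  qed
  then have fc: "\<zeta> (f - c) = 0" by (simp add: c_def)
  have "c - f = mvconst (-1) * (f - c)"
    by (simp add: mvconst_def single_uminus)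
  with fc have cf: "\<zeta> (c - f) = 0" by (simp add: berk_affineD(4)[OF \<zeta>])
  have "\<zeta> f = \<zeta> c"
    using berk_affineD(3)[OF \<zeta>, of "f - c" c] berk_affineD(3)[OF \<zeta>, of "c - f" f] fc cf
      berk_affineD(1)[OF \<zeta>, of f] berk_affineD(1)[OF \<zeta>, of c] by simp
  then show "\<zeta> f = berk_zero absv f"
    by (simp add: c_def berk_affineD(2)[OF \<zeta>] berk_zero_def mveval_zero)
qed

lemma berk_punctured_iff:
  assumes absv: "nonarch_complete absv"
  shows "\<zeta> \<in> berk_punctured absv \<longleftrightarrow> \<zeta> \<in> berk_affine absv \<and> 0 < berk_norm \<zeta>"
proof -
  have "berk_norm (berk_zero absv :: ('b, 'a) mvpoly \<Rightarrow> real) = 0"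
    by (simp add: berk_norm_def berk_zero_def mveval_zero mvvar_def lookup_single absv_zero[OF absv]
        when_def poly_mapping_eq_iff fun_eq_iff)
  then show ?thesis
    using berk_norm_eq_0_imp[OF absv, of \<zeta>] berk_norm_nonneg[of \<zeta> absv]
    by (auto simp: berk_punctured_def less_le)
qed

definition berk_scale ::
  "'k::comm_ring_1 \<Rightarrow> (('v::finite, 'k) mvpoly \<Rightarrow> real) \<Rightarrow> ('v, 'k) mvpoly \<Rightarrow> real" where
  "berk_scale c \<zeta> f = \<zeta> (scale_vars c f)"

lemma berk_scale_affine:
  assumes "\<zeta> \<in> berk_affine absv"
  shows "berk_scale c \<zeta> \<in> berk_affine absv"
  using assms
  by (simp add: berk_affine_def berk_scale_def scale_vars_add scale_vars_mult scale_vars_mvconst)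

lemma berk_scale_homogeneous:
  assumes "nonarch_complete absv" "\<zeta> \<in> berk_affine absv" "homogeneous f"
  shows "berk_scale c \<zeta> f = absv c ^ mvdegree f * \<zeta> f"
  using assms
  by (simp add: berk_scale_def scale_vars_homogeneous berk_affineD(4)[OF assms(2)]
      berk_affineD(2)[OF assms(2)] absv_power)

lemma berk_norm_scale:
  assumes absv: "nonarch_complete absv" and \<zeta>: "\<zeta> \<in> berk_affine absv"
  shows "berk_norm (berk_scale c \<zeta>) = absv c * berk_norm \<zeta>"
proof -
  have "berk_norm (berk_scale c \<zeta>) = Max ((*) (absv c) ` (\<lambda>i. \<zeta> (mvvar i)) ` UNIV)"
    by (simp add: berk_norm_def image_image homogeneous_mvvar mvdegree_mvvar
        berk_scale_homogeneous[OF absv \<zeta>])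
  also have "\<dots> = absv c * berk_norm \<zeta>"
    unfolding berk_norm_def using nonarch_complete.absv_nonneg[OF absv, of c]
    by (subst mono_Max_commute[where f = "(*) (absv c)"]) (auto simp: mono_def mult_left_mono)
  finally show ?thesis .
qed

lemma berk_pi_eq_iff:
  assumes "\<zeta> \<in> berk_punctured absv" "\<xi> \<in> berk_punctured absv"
  shows "berk_pi absv \<zeta> = berk_pi absv \<xi> \<longleftrightarrow> (\<zeta>, \<xi>) \<in> berk_rel absv"
  unfolding berk_pi_def using equiv_berk_rel assms by (rule eq_equiv_class_iff)

section \<open>Compactness of projective space\<close>

lemma continuous_map_Max:
  fixes f :: "'i \<Rightarrow> 'a \<Rightarrow> real"
  assumes "finite I" "I \<noteq> {}" "\<And>i. i \<in> I \<Longrightarrow> continuous_map X euclideanreal (f i)"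
  shows "continuous_map X euclideanreal (\<lambda>x. Max ((\<lambda>i. f i x) ` I))"
  using assms by (induction rule: finite_ne_induct) (auto intro!: continuous_map_real_max)

definition berk_annulus ::
  "('k::field \<Rightarrow> real) \<Rightarrow> real \<Rightarrow> (('v::finite, 'k) mvpoly \<Rightarrow> real) set" where
  "berk_annulus absv r = {\<zeta> \<in> berk_affine absv. 1 \<le> berk_norm \<zeta> \<and> berk_norm \<zeta> \<le> r}"

text \<open>
  In the product topology on all real functions of polynomials, the annulus is closed, as it is cut
  out by weak inequalities and equations between continuous expressions in finitely many
  coordinates, and it lies in a product of compact intervals.
\<close>

lemma compact_berk_annulus:
  assumes absv: "nonarch_complete absv"
  shows "compact (berk_annulus absv r :: (('v::finite, 'k::field) mvpoly \<Rightarrow> real) set)"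
proof -
  let ?A = "berk_annulus absv r :: (('v, 'k) mvpoly \<Rightarrow> real) set"
  have ev: "continuous_on UNIV (\<lambda>\<zeta> :: ('v, 'k) mvpoly \<Rightarrow> real. \<zeta> f)" for f
    by (rule continuous_on_product_coordinates)
  have "continuous_map euclidean euclideanreal (berk_norm :: (('v, 'k) mvpoly \<Rightarrow> real) \<Rightarrow> real)"
    unfolding berk_norm_def using ev by (intro continuous_map_Max) auto
  then have norm: "continuous_on UNIV (berk_norm :: (('v, 'k) mvpoly \<Rightarrow> real) \<Rightarrow> real)" by simp
  have "closed ?A"
    unfolding berk_annulus_def berk_affine_def mem_Collect_eq
    by (intro closed_Collect_conj closed_Collect_all closed_Collect_le closed_Collect_eq
        continuous_on_const continuous_on_max continuous_on_mult ev norm)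
  have "\<forall>f :: ('v, 'k) mvpoly. \<exists>B. \<forall>\<zeta>\<in>berk_affine absv. berk_norm \<zeta> \<le> r \<longrightarrow> \<zeta> f \<le> B"
    using berk_affine_bounded[OF absv] by (rule allI)
  from choice[OF this] obtain B where
    B: "\<And>(f :: ('v, 'k) mvpoly) \<zeta>. \<zeta> \<in> berk_affine absv \<Longrightarrow> berk_norm \<zeta> \<le> r \<Longrightarrow> \<zeta> f \<le> B f"
    by auto
  have "compactin (product_topology (\<lambda>_. euclideanreal) UNIV) (PiE UNIV (\<lambda>f :: ('v, 'k) mvpoly. {0..B f}))"
    unfolding compactin_PiE by simp
  then have "compact (PiE UNIV (\<lambda>f :: ('v, 'k) mvpoly. {0..B f}))"
    by (simp add: euclidean_product_topology)
  from compact_Int_closed[OF this \<open>closed ?A\<close>]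
  have "compact (PiE UNIV (\<lambda>f :: ('v, 'k) mvpoly. {0..B f}) \<inter> ?A)" .
  moreover have "?A \<subseteq> PiE UNIV (\<lambda>f :: ('v, 'k) mvpoly. {0..B f})"
    using B berk_affineD(1) by (auto simp: berk_annulus_def)
  ultimately show ?thesis by (simp add: Int_absorb1)
qed

text \<open>
  The topology of affine space is generated by preimages of open sets under coordinates, so the
  product topology is at least as fine, and compactness is inherited by the coarser topology.
\<close>

lemma compactin_berk_affine_top:
  fixes A :: "(('v, 'k::field) mvpoly \<Rightarrow> real) set"
  assumes "compact A" "A \<subseteq> berk_affine absv"
  shows "compactin (berk_affine_top absv) A"
proof -
  have "continuous_map (subtopology euclidean (berk_affine absv)) (berk_affine_top absv) id"
    unfolding berk_affine_top_def
  proof (rule continuous_on_generated_topo, goal_cases)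
    case (1 U)
    then obtain f V where "U = berk_affine absv \<inter> {\<zeta>. \<zeta> f \<in> V}" "open V" by auto
    then show ?case
      by (auto simp: Int_commute intro!: openin_open_Int open_coordinate_preimage)
  qed (auto intro!: exI[of _ UNIV])
  from image_compactin[OF _ this, of A] assms show ?thesis
    by (simp add: compactin_subtopology)
qed

text \<open>
  Projective space is the image of the annulus under the quotient map: a representative of a point
  is moved into the annulus by rescaling the variables, without changing the point.
\<close>

lemma compact_space_berk_proj_top:
  assumes absv: "nonarch_complete absv"
  shows "compact_space (berk_proj_top absv :: ('v::finite, 'k::field) proj_point topology)"
proof -
  obtain c where c: "1 < absv c" using ex_absv_gt_1[OF absv] by auto
  let ?A = "berk_annulus absv (absv c) :: (('v, 'k) mvpoly \<Rightarrow> real) set"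
  have A: "?A \<subseteq> berk_punctured absv"
    by (auto simp: berk_annulus_def berk_punctured_iff[OF absv])
  have "berk_proj absv \<subseteq> berk_pi absv ` ?A"
  proof
    fix p :: "('v, 'k) proj_point" assume "p \<in> berk_proj absv"
    then obtain \<zeta> where \<zeta>: "\<zeta> \<in> berk_punctured absv" "p = berk_pi absv \<zeta>"
      by (auto simp flip: berk_pi_image)
    then have aff: "\<zeta> \<in> berk_affine absv" "0 < berk_norm \<zeta>"
      by (simp_all add: berk_punctured_iff[OF absv])
    obtain d where d: "1 \<le> absv d * berk_norm \<zeta>" "absv d * berk_norm \<zeta> \<le> absv c"
      using ex_rescale_into_annulus[OF absv c aff(2)] by auto
    have "absv d \<noteq> 0" using d(1) by auto
    then have "0 < absv d" using nonarch_complete.absv_nonneg[OF absv, of d] by simp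
    have ann: "berk_scale d \<zeta> \<in> ?A"
      using d aff by (simp add: berk_annulus_def berk_scale_affine berk_norm_scale[OF absv])
    then have "(berk_scale d \<zeta>, \<zeta>) \<in> berk_rel absv"
      using A \<zeta>(1) berk_scale_homogeneous[OF absv aff(1)] \<open>0 < absv d\<close>
      by (auto simp: berk_rel_def)
    then have "berk_pi absv (berk_scale d \<zeta>) = p"
      using berk_pi_eq_iff[of "berk_scale d \<zeta>" absv \<zeta>] A ann \<zeta> by auto
    with ann show "p \<in> berk_pi absv ` ?A" by auto
  qed
  moreover have "berk_pi absv ` ?A \<subseteq> berk_proj absv"
    using A berk_pi_image by blast
  ultimately have eq: "berk_pi absv ` ?A = berk_proj absv" by auto
  have "compactin (subtopology (berk_affine_top absv) (berk_punctured absv)) ?A"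
    using A compactin_berk_affine_top[OF compact_berk_annulus[OF absv]]
    by (auto simp: compactin_subtopology berk_annulus_def)
  from image_compactin[OF this quotient_imp_continuous_map[OF quotient_map_berk_pi]]
  show ?thesis by (simp add: compact_space_def eq)
qed

section \<open>The functions \<open>\<lambda>\<^sub>f\<close>\<close>

lemma berk_proj_cases:
  assumes "p \<in> berk_proj absv"
  obtains \<zeta> where "\<zeta> \<in> berk_punctured absv" "p = berk_pi absv \<zeta>"
  using assms by (auto simp flip: berk_pi_image)

lemma continuous_map_lambda_fun:
  fixes f :: "('v::finite, 'k::field) mvpoly"
  assumes absv: "nonarch_complete absv" and f: "homogeneous f"
  shows "continuous_map (berk_proj_top absv) euclideanreal (lambda_fun f)"
proof (rule continuous_compose_quotient_map[OF quotient_map_berk_pi])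
  let ?P = "subtopology (berk_affine_top absv) (berk_punctured absv :: (('v, 'k) mvpoly \<Rightarrow> real) set)"
  have "continuous_map (berk_affine_top absv) euclideanreal (\<lambda>\<zeta>. \<zeta> g)" for g :: "('v, 'k) mvpoly"
    unfolding continuous_map_def topspace_berk_affine_top
    by (auto simp: berk_affine_top_def intro!: topology_generated_by_Basis)
  then have ev: "continuous_map ?P euclideanreal (\<lambda>\<zeta>. \<zeta> g)" for g :: "('v, 'k) mvpoly"
    by (rule continuous_map_from_subtopology)
  have "continuous_map ?P euclideanreal berk_norm"
    unfolding berk_norm_def using ev by (intro continuous_map_Max) auto
  then have "continuous_map ?P euclideanreal (\<lambda>\<zeta>. \<zeta> f / berk_norm \<zeta> ^ mvdegree f)"
    by (intro continuous_map_real_divide continuous_map_real_pow ev)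
      (auto simp: berk_punctured_iff[OF absv])
  then show "continuous_map ?P euclideanreal (lambda_fun f \<circ> berk_pi absv)"
    by (rule continuous_map_eq) (simp add: lambda_fun_berk_pi[OF _ f])
qed

text \<open>
  This is multiplicativity of the seminorm, together with additivity of degrees. The degree of a zero
  product is \<open>0\<close> by convention rather than the sum of the degrees, but then both sides vanish.
\<close>

lemma lambda_fun_mult:
  assumes absv: "nonarch_complete absv" and f: "homogeneous f" and g: "homogeneous g"
    and p: "p \<in> berk_proj absv"
  shows "lambda_fun (f * g) p = lambda_fun f p * lambda_fun g p"
proof -
  obtain \<zeta> where \<zeta>: "\<zeta> \<in> berk_punctured absv" "p = berk_pi absv \<zeta>" using p by (rule berk_proj_cases)
  have aff: "\<zeta> \<in> berk_affine absv" using \<zeta>(1) by (simp add: berk_punctured_def)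
  have *: "\<zeta> (f * g) = \<zeta> f * \<zeta> g" using berk_affineD(4)[OF aff] .
  have eq: "lambda_fun f p * lambda_fun g p = \<zeta> (f * g) / berk_norm \<zeta> ^ (mvdegree f + mvdegree g)"
    using \<zeta> f g by (simp add: lambda_fun_berk_pi * power_add)
  show ?thesis
  proof (cases "f * g = 0")
    case True
    then show ?thesis
      using eq \<zeta> berk_affine_zero[OF absv aff] homogeneous_mult[OF f g] by (simp add: lambda_fun_berk_pi)
  next
    case False
    then show ?thesis
      using eq \<zeta> by (simp add: lambda_fun_berk_pi homogeneous_mult[OF f g] mvdegree_mult[OF f g])
  qed
qed

lemma lambda_fun_mvconst:
  assumes "p \<in> berk_proj absv"
  shows "lambda_fun (mvconst a) p = absv a"
proof -
  obtain \<zeta> where \<zeta>: "\<zeta> \<in> berk_punctured absv" "p = berk_pi absv \<zeta>" using assms by (rule berk_proj_cases)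
  then show ?thesis
    by (simp add: lambda_fun_berk_pi homogeneous_mvconst mvdegree_mvconst berk_punctured_def
        berk_affineD(2))
qed

lemma lambda_fun_zero:
  assumes absv: "nonarch_complete absv" and p: "p \<in> berk_proj absv"
  shows "lambda_fun 0 p = 0"
  using lambda_fun_mvconst[OF p, of 0] absv_zero[OF absv] by (simp add: mvconst_def)

text \<open>
  For representatives \<open>\<zeta>\<close> and \<open>\<xi>\<close>, the hypothesis says that their values on homogeneous
  polynomials agree up to the factor \<open>(\<parallel>\<zeta>\<parallel> / \<parallel>\<xi>\<parallel>)\<^bsup>deg f\<^esup>\<close>, which is the equivalence of \<open>\<zeta>\<close> and \<open>\<xi>\<close>.
\<close>

lemma berk_proj_eqI:
  assumes absv: "nonarch_complete absv" and p: "p \<in> berk_proj absv" and q: "q \<in> berk_proj absv"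
    and eq: "\<And>f. homogeneous f \<Longrightarrow> lambda_fun f p = lambda_fun f q"
  shows "p = q"
proof -
  obtain \<zeta> where \<zeta>: "\<zeta> \<in> berk_punctured absv" "p = berk_pi absv \<zeta>" using p by (rule berk_proj_cases)
  obtain \<xi> where \<xi>: "\<xi> \<in> berk_punctured absv" "q = berk_pi absv \<xi>" using q by (rule berk_proj_cases)
  have pos: "0 < berk_norm \<zeta>" "0 < berk_norm \<xi>"
    using \<zeta>(1) \<xi>(1) by (simp_all add: berk_punctured_iff[OF absv])
  have "\<zeta> f = (berk_norm \<zeta> / berk_norm \<xi>) ^ mvdegree f * \<xi> f" if "homogeneous f" for f
    using eq[OF that] pos unfolding \<zeta>(2) \<xi>(2) lambda_fun_berk_pi[OF \<zeta>(1) that]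
      lambda_fun_berk_pi[OF \<xi>(1) that]
    by (simp add: power_divide field_simps)
  moreover have "berk_norm \<zeta> / berk_norm \<xi> > 0" using pos by simp
  ultimately have "(\<zeta>, \<xi>) \<in> berk_rel absv"
    using \<zeta>(1) \<xi>(1) unfolding berk_rel_def by blast
  then show ?thesis using berk_pi_eq_iff \<zeta> \<xi> by blast
qed

lemma ex_normalized_multiple:
  fixes f :: "('v::finite, 'k::field) mvpoly"
  assumes absv: "nonarch_complete absv" and "f \<noteq> 0"
  shows "\<exists>a. a \<noteq> 0 \<and> normalized absv (mvconst a * f)"
proof -
  let ?v = "\<lambda>m. absv (Poly_Mapping.lookup f m)"
  have ne: "Poly_Mapping.keys f \<noteq> {}" using \<open>f \<noteq> 0\<close> by simp
  then have "Max (?v ` Poly_Mapping.keys f) \<in> ?v ` Poly_Mapping.keys f" by (intro Max_in) auto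
  then obtain m where m: "m \<in> Poly_Mapping.keys f" "?v m = Max (?v ` Poly_Mapping.keys f)" by auto
  have max: "?v n \<le> ?v m" if "n \<in> Poly_Mapping.keys f" for n
    unfolding m(2) using that by (intro Max_ge) auto
  define a where "a = 1 / Poly_Mapping.lookup f m"
  have m0: "Poly_Mapping.lookup f m \<noteq> 0" using m(1) by (simp add: in_keys_iff)
  then have "a \<noteq> 0" by (simp add: a_def)
  have pos: "?v m > 0"
    using m0 nonarch_complete.absv_eq_0_iff[OF absv] nonarch_complete.absv_nonneg[OF absv]
    by (simp add: less_le)
  have keys: "Poly_Mapping.keys (mvconst a * f) = Poly_Mapping.keys f"
    using \<open>a \<noteq> 0\<close> by (auto simp: in_keys_iff lookup_mvconst_mult)
  have val: "absv (Poly_Mapping.lookup (mvconst a * f) n) = ?v n / ?v m" for n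
    by (simp add: lookup_mvconst_mult a_def absv_divide[OF absv])
  have "height absv (mvconst a * f) = 1"
    unfolding height_def keys val
  proof (rule Max_eqI)
    show "1 \<in> insert 0 ((\<lambda>n. ?v n / ?v m) ` Poly_Mapping.keys f)"
      using m(1) pos by (auto simp: image_iff intro!: bexI[of _ m])
  qed (use max pos in auto)
  with \<open>a \<noteq> 0\<close> show ?thesis by (auto simp: normalized_def)
qed

lemma normalized_mvconst_1:
  "nonarch_complete absv \<Longrightarrow> normalized absv (mvconst 1)"
  by (simp add: normalized_def height_def mvconst_def absv_one)

text \<open>
  Normalized polynomials thus span the same functions as all homogeneous ones, and separate the same
  points.
\<close>

lemma lambda_fun_eq_scaled_normalized:
  fixes f :: "('v::finite, 'k::field) mvpoly"
  assumes absv: "nonarch_complete absv" and f: "homogeneous f"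
  shows "\<exists>g r. homogeneous g \<and> normalized absv g \<and>
    (\<forall>p\<in>berk_proj absv. lambda_fun f p = r * lambda_fun g p)"
proof (cases "f = 0")
  case True
  show ?thesis
    using True normalized_mvconst_1[OF absv] lambda_fun_zero[OF absv] homogeneous_mvconst
    by (intro exI[of _ "mvconst 1"] exI[of _ 0]) auto
next
  case False
  then obtain a where a: "a \<noteq> 0" "normalized absv (mvconst a * f)"
    using ex_normalized_multiple[OF absv] by blast
  have "absv a \<noteq> 0" using a(1) nonarch_complete.absv_eq_0_iff[OF absv] by simp
  then have "\<forall>p\<in>berk_proj absv. lambda_fun f p = 1 / absv a * lambda_fun (mvconst a * f) p"
    by (simp add: lambda_fun_mult[OF absv homogeneous_mvconst f] lambda_fun_mvconst)
  then show ?thesis using a(2) homogeneous_mult[OF homogeneous_mvconst f] by blast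
qed

theorem theorem5:
  fixes absv :: "'k::field \<Rightarrow> real"
    and N :: nat
    and I :: "'i set" and le :: "'i \<Rightarrow> 'i \<Rightarrow> bool"
    and \<mu>s :: "'i \<Rightarrow> ('v::finite, 'k) proj_point measure"
    and \<mu> :: "('v, 'k) proj_point measure"
  assumes "nonarch_complete absv"
    and "N \<ge> 1" and "CARD('v) = N + 1"
    and "directed_set I le"
    and "\<And>\<alpha>. \<alpha> \<in> I \<Longrightarrow> unit_borel_measure (berk_proj_top absv) (\<mu>s \<alpha>)"
    and "unit_borel_measure (berk_proj_top absv) \<mu>"
  shows "weak_conv_net (berk_proj_top absv) (net_filter I le) \<mu>s \<mu> \<longleftrightarrow>
    (\<forall>f :: ('v, 'k) mvpoly. homogeneous f \<and> normalized absv f \<longrightarrow>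
      ((\<lambda>\<alpha>. \<integral>p. lambda_fun f p \<partial>\<mu>s \<alpha>) \<longlongrightarrow> (\<integral>p. lambda_fun f p \<partial>\<mu>)) (net_filter I le))"
proof -
  have unit: "\<forall>\<^sub>F \<alpha> in net_filter I le. unit_borel_measure (berk_proj_top absv) (\<mu>s \<alpha>)"
    using assms(4,5) by (auto simp: eventually_net_filter directed_set_def)
  let ?L = "lambda_fun ` {f :: ('v, 'k) mvpoly. homogeneous f \<and> normalized absv f}"
  show ?thesis
  proof
    assume "weak_conv_net (berk_proj_top absv) (net_filter I le) \<mu>s \<mu>"
    then show "\<forall>f :: ('v, 'k) mvpoly. homogeneous f \<and> normalized absv f \<longrightarrow>
      ((\<lambda>\<alpha>. \<integral>p. lambda_fun f p \<partial>\<mu>s \<alpha>) \<longlongrightarrow> (\<integral>p. lambda_fun f p \<partial>\<mu>)) (net_filter I le)"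
      unfolding weak_conv_net_def by (blast intro: continuous_map_lambda_fun[OF assms(1)])
  next
    assume conv: "\<forall>f :: ('v, 'k) mvpoly. homogeneous f \<and> normalized absv f \<longrightarrow>
      ((\<lambda>\<alpha>. \<integral>p. lambda_fun f p \<partial>\<mu>s \<alpha>) \<longlongrightarrow> (\<integral>p. lambda_fun f p \<partial>\<mu>)) (net_filter I le)"
    show "weak_conv_net (berk_proj_top absv) (net_filter I le) \<mu>s \<mu>"
    proof (rule weak_conv_net_if_separating[OF compact_space_berk_proj_top[OF assms(1)] unit assms(6)])
      fix u assume "u \<in> ?L"
      then show "continuous_map (berk_proj_top absv) euclideanreal u"
        using continuous_map_lambda_fun[OF assms(1)] by auto
    next
      have "normalized absv (mvconst 1 :: ('v, 'k) mvpoly)"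
        by (rule normalized_mvconst_1[OF assms(1)])
      then have "lambda_fun (mvconst 1) \<in> ?L" using homogeneous_mvconst by blast
      then show "\<exists>h\<in>?L. \<forall>p\<in>topspace (berk_proj_top absv). h p = 1"
        by (rule rev_bexI) (simp add: lambda_fun_mvconst absv_one[OF assms(1)])
    next
      fix u v assume "u \<in> ?L" "v \<in> ?L"
      then obtain f g :: "('v, 'k) mvpoly" where
        fg: "u = lambda_fun f" "v = lambda_fun g" "homogeneous f" "homogeneous g" by auto
      obtain h :: "('v, 'k) mvpoly" and r where h: "homogeneous h" "normalized absv h"
        "\<forall>p\<in>berk_proj absv. lambda_fun (f * g) p = r * lambda_fun h p"
        using lambda_fun_eq_scaled_normalized[OF assms(1) homogeneous_mult[OF fg(3,4)]] by auto
      have "\<forall>p\<in>topspace (berk_proj_top absv). u p * v p = r * lambda_fun h p"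
        using h(3) by (simp add: fg lambda_fun_mult[OF assms(1) fg(3,4)])
      moreover have "lambda_fun h \<in> ?L" using h(1,2) by auto
      ultimately show "\<exists>h\<in>?L. \<exists>c. \<forall>p\<in>topspace (berk_proj_top absv). u p * v p = c * h p"
        by blast
    next
      fix p q :: "('v, 'k) proj_point"
      assume pq: "p \<in> topspace (berk_proj_top absv)" "q \<in> topspace (berk_proj_top absv)" "p \<noteq> q"
      then obtain f :: "('v, 'k) mvpoly" where f: "homogeneous f" "lambda_fun f p \<noteq> lambda_fun f q"
        using berk_proj_eqI[OF assms(1), of p q] by auto
      obtain g :: "('v, 'k) mvpoly" and r where g: "homogeneous g" "normalized absv g"
        "\<forall>p\<in>berk_proj absv. lambda_fun f p = r * lambda_fun g p"
        using lambda_fun_eq_scaled_normalized[OF assms(1) f(1)] by auto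
      have "lambda_fun g p \<noteq> lambda_fun g q" using f(2) g(3) pq(1,2) by auto
      with g(1,2) show "\<exists>u\<in>?L. u p \<noteq> u q" by auto
    next
      fix u assume "u \<in> ?L"
      with conv show "((\<lambda>\<alpha>. \<integral>p. u p \<partial>\<mu>s \<alpha>) \<longlongrightarrow> (\<integral>p. u p \<partial>\<mu>)) (net_filter I le)" by auto
    qed
  qed
qed

end
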